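(* Let $d,r\in\mathbb{N}$, let $A_d:\mathbb{R}^d\to\mathbb{R}^r$ be any Borel measurable map, and let $\mu_1,\dots,\mu_d$ be Borel probability measures on $\mathbb{R}$. Let $(\psi_k)_{k\in\mathbb{N}}$ be any sequence of gauge functions on $\mathbb{R}$ that are all convex and even, and consider the sequence of gauge functions $(\widetilde\psi_k)$ on $\mathbb{R}^r$ with $\widetilde\psi_k(\cdot):=\psi_k(\|\cdot\|)$, where $\|\cdot\|$ is the Euclidean norm. Assume: (a) There exist constants $b,c>0$ such that $\|A_d(\boldsymbol{x})\|\le b+c\sum_{i=1}^d|x_i|$ for all $\boldsymbol{x}=(x_1,\ldots,x_d)\in\mathbb{R}^d$. (b) For every $k\in\mathbb{N}$ there exist $\ell_k\in\mathbb{N}$ and $c_k>0$ such that $\psi_k((d+1)cx)\le c_k\psi_{\ell_k}(x)$ for all $x\in\mathbb{R}$, where $c$ is the constant from (a). (c) $\int\psi_k\,d\mu_i<\infty$ for all $k\in\mathbb{N}$ and $i=1,\dots,d$. Then the set $M:=\{\boldsymbol{\mu}\circ A_d^{-1}:\boldsymbol{\mu}\in\boldsymbol{\mathcal{M}}(d;\mu_1,\dots,\mu_d)\}$ is uniformly $(\widetilde\psi_k)$-integrating, and thus it is a w-set in $\mathcal{M}_1^{(\widetilde\psi_k)}$.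
   Context: $\boldsymbol{\mathcal{M}}(d;\mu_1,\dots,\mu_d)$ denotes the set of all Borel probability measures on $\mathbb{R}^d$ whose one-dimensional marginal distributions are $\mu_1,\dots,\mu_d$ (Fréchet class). A gauge function on a Polish space $E$ is a continuous function $E\to[0,\infty)$. For a sequence $(\phi_k)$ of gauge functions on $E$: $\mathcal{M}_1^{(\phi_k)}$ is the set of all Borel probability measures $\mu$ on $E$ with $\int\phi_k\,d\mu<\infty$ for every $k$; the $(\phi_k)$-weak topology on it is the coarsest topology for which all mappings $\mu\mapsto\int f\,d\mu$ are continuous, where $f$ ranges over all continuous $f:E\to\mathbb{R}$ with $\sup_x|f(x)/(1+\phi_k(x))|<\infty$ for some $k\in\mathbb{N}$; a subset $M\subseteq\mathcal{M}_1^{(\phi_k)}$ is a w-set in $\mathcal{M}_1^{(\phi_k)}$ if the relative $(\phi_k)$-weak topology and the relative weak topology on $M$ coincide; a set $M$ of Borel probability measures on $E$ is uniformly $(\phi_k)$-integrating if for every $\varepsilon>0$ and $k\in\mathbb{N}$ there exists $a>0$ with $\sup_{\mu\in M}\int\phi_k\mathbf{1}_{\{\phi_k\ge a\}}\,d\mu\le\varepsilon$. Here these notions are used with $E=\mathbb{R}^r$ and $\phi_k=\widetilde\psi_k$. *)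

theory Defs
  imports "HOL-Probability.Probability"
begin

definition borel_prob_measures :: "'a::topological_space measure set" where
  "borel_prob_measures = {\<mu>. prob_space \<mu> \<and> sets \<mu> = sets borel}"

definition frechet_class :: "('d::finite \<Rightarrow> real measure) \<Rightarrow> (real ^ 'd) measure set" where
  "frechet_class \<mu> =
     {P \<in> borel_prob_measures. \<forall>i. distr P borel (\<lambda>x. x $ i) = \<mu> i}"

definition gauge_function :: "('a::polish_space \<Rightarrow> real) \<Rightarrow> bool" where
  "gauge_function \<phi> \<longleftrightarrow> continuous_on UNIV \<phi> \<and> (\<forall>x. 0 \<le> \<phi> x)"

definition gauge_measures :: "(nat \<Rightarrow> 'a::polish_space \<Rightarrow> real) \<Rightarrow> 'a measure set" where
  "gauge_measures \<phi> =
     {\<mu> \<in> borel_prob_measures. \<forall>k. (\<integral>\<^sup>+x. ennreal (\<phi> k x) \<partial>\<mu>) < \<infinity>}"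

text \<open>
  The initial topology on \<open>S\<close> with respect to the maps \<open>\<mu> \<mapsto> \<integral> f d\<mu>\<close>, \<open>f \<in> F\<close>, given by its
  canonical subbase. The set \<open>S\<close> itself is added to the subbase so that the topology lives
  on \<open>S\<close> even when \<open>F\<close> is empty.
\<close>
definition integral_topology :: "'a measure set \<Rightarrow> ('a \<Rightarrow> real) set \<Rightarrow> 'a measure topology" where
  "integral_topology S F =
     topology_generated_by
       (insert S {{\<mu> \<in> S. (\<integral>x. f x \<partial>\<mu>) \<in> U} | f U. f \<in> F \<and> open U})"

lemma topspace_integral_topology [simp]: "topspace (integral_topology S F) = S"
  by (auto simp: integral_topology_def)

lemma continuous_map_integral_topology:
  assumes "f \<in> F"
  shows "continuous_map (integral_topology S F) euclideanreal (\<lambda>\<mu>. \<integral>x. f x \<partial>\<mu>)"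
proof -
  have "openin (integral_topology S F) {\<mu> \<in> S. (\<integral>x. f x \<partial>\<mu>) \<in> U}" if "open U" for U
    unfolding integral_topology_def using assms that
    by (intro topology_generated_by_Basis) auto
  then show ?thesis
    by (simp add: continuous_map_def)
qed

lemma integral_topology_coarsest:
  assumes T: "topspace T = S"
    and cont: "\<And>f. f \<in> F \<Longrightarrow> continuous_map T euclideanreal (\<lambda>\<mu>. \<integral>x. f x \<partial>\<mu>)"
    and U: "openin (integral_topology S F) U"
  shows "openin T U"
proof -
  have *: "openin T B"
    if "B \<in> insert S {{\<mu> \<in> S. (\<integral>x. f x \<partial>\<mu>) \<in> U} | f U. f \<in> F \<and> open U}" for B
    using that T cont by (auto simp: continuous_map_def)
  from U have "generate_topology_on
      (insert S {{\<mu> \<in> S. (\<integral>x. f x \<partial>\<mu>) \<in> U} | f U. f \<in> F \<and> open U}) U"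
    by (simp add: integral_topology_def openin_topology_generated_by)
  then show ?thesis
    by induction (auto intro: *)
qed

definition gauge_weak_topology ::
    "(nat \<Rightarrow> 'a::polish_space \<Rightarrow> real) \<Rightarrow> 'a measure topology" where
  "gauge_weak_topology \<phi> =
     integral_topology (gauge_measures \<phi>)
       {f. continuous_on UNIV f \<and> (\<exists>k. bdd_above (range (\<lambda>x. \<bar>f x / (1 + \<phi> k x)\<bar>)))}"

definition weak_topology :: "'a::polish_space measure topology" where
  "weak_topology =
     integral_topology borel_prob_measures {f. continuous_on UNIV f \<and> bounded (range f)}"

definition w_set :: "(nat \<Rightarrow> 'a::polish_space \<Rightarrow> real) \<Rightarrow> 'a measure set \<Rightarrow> bool" where
  "w_set \<phi> M \<longleftrightarrow>
     M \<subseteq> gauge_measures \<phi> \<and>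
     subtopology (gauge_weak_topology \<phi>) M = subtopology weak_topology M"

definition uniformly_integrating ::
    "(nat \<Rightarrow> 'a::polish_space \<Rightarrow> real) \<Rightarrow> 'a measure set \<Rightarrow> bool" where
  "uniformly_integrating \<phi> M \<longleftrightarrow>
     M \<subseteq> borel_prob_measures \<and>
     (\<forall>\<epsilon>>0. \<forall>k. \<exists>a>0.
        (SUP \<mu>\<in>M. \<integral>\<^sup>+x. ennreal (\<phi> k x) * indicator {y. a \<le> \<phi> k y} x \<partial>\<mu>) \<le> ennreal \<epsilon>)"

end

theory Submission imports Defs begin

text \<open>
  A nonnegative even convex function is increasing in \<open>\<bar>x\<bar>\<close>. Once \<open>\<psi>\<^sub>k \<parallel>A x\<parallel>\<close> exceeds
  \<open>\<psi>\<^sub>k ((d + 1) b)\<close>, the growth bound on \<open>A\<close> therefore forces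
  \<open>\<psi>\<^sub>k \<parallel>A x\<parallel> \<le> \<psi>\<^sub>k ((d + 1) c x\<^sub>i) \<le> C \<psi>\<^sub>l (x\<^sub>i)\<close> for some coordinate \<open>i\<close>. The tail integrals
  of \<open>\<psi>\<^sub>k \<parallel>A x\<parallel>\<close> are thus bounded by those of \<open>C \<psi>\<^sub>l\<close> under the marginals, uniformly over
  the Frechet class. Truncation turns uniform integrability into equality of the topologies.
\<close>

section \<open>Integral topologies\<close>

text \<open>The trace on \<open>M\<close> of a subbasic set over \<open>S\<close> is the subbasic
  set over \<open>M\<close> for the same \<open>f\<close> and the same open set. Both topologies in
  \<open>w_set\<close> thereby become integral topologies on the common carrier \<open>M\<close> and
  differ only in their test functions.\<close>

lemma subtopology_integral_topology:
  assumes "M \<subseteq> S"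
  shows "subtopology (integral_topology S F) M = integral_topology M F"
proof (rule topology_eq[THEN iffD2], intro allI iffI)
  fix U
  assume "openin (integral_topology M F) U"
  then show "openin (subtopology (integral_topology S F) M) U"
  proof (rule integral_topology_coarsest[rotated -1])
    show "topspace (subtopology (integral_topology S F) M) = M"
      using assms by auto
  qed (intro continuous_map_from_subtopology continuous_map_integral_topology)
next
  fix U
  let ?T = "subtopology (integral_topology S F) M"
  assume U: "openin ?T U"
  \<comment> \<open>The inclusion of \<open>M\<close> into \<open>S\<close> is continuous, and the
    trace of an open set on \<open>M\<close> is its preimage under this inclusion.\<close>
  have "continuous_map (integral_topology M F) (integral_topology S F) (\<lambda>x. x)"
    unfolding integral_topology_def[of S]
  proof (rule continuous_on_generated_topo)
    fix B
    assume "B \<in> insert S {{\<mu> \<in> S. (\<integral>x. f x \<partial>\<mu>) \<in> U} |f U. f \<in> F \<and> open U}"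
    then consider "B = S" |
      f V where "f \<in> F" "open V" "B = {\<mu> \<in> S. (\<integral>x. f x \<partial>\<mu>) \<in> V}"
      by auto
    then show "openin (integral_topology M F)
        ((\<lambda>x. x) -` B \<inter> topspace (integral_topology M F))"
    proof cases
      case 1
      then have "(\<lambda>x. x) -` B \<inter> topspace (integral_topology M F) = topspace (integral_topology M F)"
        using assms by auto
      then show ?thesis
        by (metis openin_topspace)
    next
      case 2
      then have "(\<lambda>x. x) -` B \<inter> topspace (integral_topology M F) =
          {\<mu> \<in> M. (\<integral>x. f x \<partial>\<mu>) \<in> V}"
        using assms by auto
      moreover have "openin (integral_topology M F) {\<mu> \<in> M. (\<integral>x. f x \<partial>\<mu>) \<in> V}"
        using continuous_map_integral_topology[OF 2(1), of M] 2(2)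
        by (auto simp: continuous_map_def)
      ultimately show ?thesis
        by simp
    qed
  qed (use assms in auto)
  moreover obtain V where "openin (integral_topology S F) V" "U = V \<inter> M"
    using U by (auto simp: openin_subtopology)
  ultimately show "openin (integral_topology M F) U"
    by (auto simp: continuous_map_def Int_def conj_commute dest!: conjunct2)
qed

section \<open>Uniformly integrating sets are w-sets\<close>

lemma uniformly_integratingD:
  assumes "uniformly_integrating \<phi> M" "\<epsilon> > 0"
  obtains a where "a > 0"
    "\<And>\<mu>. \<mu> \<in> M \<Longrightarrow>
      (\<integral>\<^sup>+x. ennreal (\<phi> k x) * indicator {y. a \<le> \<phi> k y} x \<partial>\<mu>) \<le> ennreal \<epsilon>"
proof -
  obtain a where "a > 0"
    "(SUP \<mu>\<in>M. \<integral>\<^sup>+x. ennreal (\<phi> k x) * indicator {y. a \<le> \<phi> k y} x \<partial>\<mu>) \<le> ennreal \<epsilon>"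
    using assms unfolding uniformly_integrating_def by blast
  then show ?thesis
    using that[of a] by (simp add: SUP_le_iff)
qed

text \<open>Split at the threshold \<open>a\<close> belonging to tail bound 1: where
  \<open>\<phi> k < a\<close> the contribution is at most \<open>a\<close>, since the total mass is
  1, and the rest contributes at most 1.\<close>

lemma uniformly_integrating_subset_gauge_measures:
  assumes \<phi>: "\<And>k. gauge_function (\<phi> k)" and M: "uniformly_integrating \<phi> M"
  shows "M \<subseteq> gauge_measures \<phi>"
proof
  fix \<mu> assume "\<mu> \<in> M"
  then have \<mu>: "\<mu> \<in> borel_prob_measures"
    using M by (auto simp: uniformly_integrating_def)
  then interpret prob_space \<mu>
    by (simp add: borel_prob_measures_def)
  have [measurable_cong]: "sets \<mu> = sets borel"
    using \<mu> by (simp add: borel_prob_measures_def)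
  have "(\<integral>\<^sup>+x. ennreal (\<phi> k x) \<partial>\<mu>) < \<infinity>" for k
  proof -
    have [measurable]: "\<phi> k \<in> borel_measurable borel"
      using \<phi> by (auto simp: gauge_function_def intro: borel_measurable_continuous_onI)
    obtain a where a: "a > 0"
      "(\<integral>\<^sup>+x. ennreal (\<phi> k x) * indicator {y. a \<le> \<phi> k y} x \<partial>\<mu>) \<le> ennreal 1"
      using uniformly_integratingD[OF M, of 1 k] \<open>\<mu> \<in> M\<close> by (metis zero_less_one)
    have "(\<integral>\<^sup>+x. ennreal (\<phi> k x) \<partial>\<mu>) \<le>
        (\<integral>\<^sup>+x. ennreal a + ennreal (\<phi> k x) * indicator {y. a \<le> \<phi> k y} x \<partial>\<mu>)"
      using a(1)
      by (intro nn_integral_mono) (auto simp: indicator_def intro: ennreal_leI)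
    also have "\<dots> = ennreal a + (\<integral>\<^sup>+x. ennreal (\<phi> k x) * indicator {y. a \<le> \<phi> k y} x \<partial>\<mu>)"
      by (subst nn_integral_add) (auto simp: emeasure_space_1)
    also have "\<dots> \<le> ennreal a + ennreal 1"
      using a(2) by (intro add_left_mono)
    also have "\<dots> < \<infinity>"
      by simp
    finally show ?thesis .
  qed
  with \<mu> show "\<mu> \<in> gauge_measures \<phi>"
    by (simp add: gauge_measures_def)
qed

text \<open>Clipping at level \<open>N\<close> changes \<open>t\<close> only if
  \<open>\<bar>t\<bar> > N\<close>. For \<open>p < a\<close> the growth bound excludes this; for
  \<open>p \<ge> a \<ge> 1\<close> the error is at most \<open>\<bar>t\<bar>\<close>, and
  \<open>1 + p \<le> 2 * p\<close>.\<close>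

lemma truncation_error_le:
  fixes t B p a N :: real
  assumes "\<bar>t\<bar> \<le> B * (1 + p)" "0 \<le> B" "0 \<le> p" "1 \<le> a" "B * (1 + a) \<le> N"
  shows "\<bar>max (- N) (min N t) - t\<bar> \<le> 2 * B * (p * indicator {y. a \<le> y} p)"
proof (cases "a \<le> p")
  case True
  have "0 \<le> N"
    using assms by (smt (verit) mult_nonneg_nonneg)
  then have "\<bar>max (- N) (min N t) - t\<bar> \<le> \<bar>t\<bar>"
    by auto
  also have "\<dots> \<le> B * (1 + p)"
    by fact
  also have "\<dots> \<le> B * (p + p)"
    using assms True by (intro mult_left_mono) auto
  finally show ?thesis
    using True by simp
next
  case False
  then have "B * (1 + p) \<le> B * (1 + a)"
    using assms by (intro mult_left_mono) auto
  then show ?thesis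
    using assms False by auto
qed

lemma integrable_gauge_bounded:
  assumes "\<mu> \<in> gauge_measures \<phi>" "\<And>k. gauge_function (\<phi> k)" "continuous_on UNIV f"
    and "\<And>x. \<bar>f x\<bar> \<le> B * (1 + \<phi> k x)"
  shows "integrable \<mu> f"
proof -
  interpret prob_space \<mu>
    using assms by (simp add: gauge_measures_def borel_prob_measures_def)
  have [measurable_cong]: "sets \<mu> = sets borel"
    using assms by (simp add: gauge_measures_def borel_prob_measures_def)
  have [measurable]: "\<phi> k \<in> borel_measurable borel" "f \<in> borel_measurable borel"
    using assms by (auto simp: gauge_function_def intro: borel_measurable_continuous_onI)
  have "integrable \<mu> (\<phi> k)"
    using assms by (intro integrableI_nonneg) (auto simp: gauge_measures_def gauge_function_def)
  then have "integrable \<mu> (\<lambda>x. B * (1 + \<phi> k x))"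
    by simp
  then show ?thesis
    by (rule Bochner_Integration.integrable_bound)
       (use assms(4) in \<open>auto intro!: AE_I2 intro: order_trans[OF _ abs_ge_self]\<close>)
qed

lemma gauge_bound_obtain:
  assumes "gauge_function \<phi>" "bdd_above (range (\<lambda>x. \<bar>f x / (1 + \<phi> x)\<bar>))"
  obtains B where "B > 0" "\<And>x. \<bar>f x\<bar> \<le> B * (1 + \<phi> x)"
proof -
  obtain B where B: "\<And>x. \<bar>f x / (1 + \<phi> x)\<bar> \<le> B"
    using assms(2) by (auto simp: bdd_above_def)
  have nonneg: "0 \<le> \<phi> x" for x
    using assms(1) by (simp add: gauge_function_def)
  \<comment> \<open>The maximum with 1 makes the constant strictly positive, so that a later choice
    of tail bound may divide by it.\<close>
  have "\<bar>f x\<bar> \<le> max B 1 * (1 + \<phi> x)" for x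
  proof -
    have "\<bar>f x\<bar> \<le> B * (1 + \<phi> x)"
      using B[of x] nonneg[of x] by (simp add: abs_divide pos_divide_le_eq)
    also have "\<dots> \<le> max B 1 * (1 + \<phi> x)"
      using nonneg[of x] by (intro mult_right_mono) auto
    finally show ?thesis .
  qed
  then show ?thesis
    using that[of "max B 1"] by simp
qed

text \<open>On a uniformly integrating set, \<open>\<integral> f d\<mu>\<close> is a uniform limit of the integrals of the
  truncations of \<open>f\<close>.\<close>

lemma continuous_map_integral_uniformly_integrating:
  assumes \<phi>: "\<And>k. gauge_function (\<phi> k)" and M: "uniformly_integrating \<phi> M"
    and f: "continuous_on UNIV f" "bdd_above (range (\<lambda>x. \<bar>f x / (1 + \<phi> k x)\<bar>))"
  shows "continuous_map (integral_topology M {f. continuous_on UNIV f \<and> bounded (range f)})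
    euclideanreal (\<lambda>\<mu>. \<integral>x. f x \<partial>\<mu>)"
proof -
  let ?T = "integral_topology M {f. continuous_on UNIV f \<and> bounded (range f)}"
  obtain B where B: "B > 0" "\<And>x. \<bar>f x\<bar> \<le> B * (1 + \<phi> k x)"
    using gauge_bound_obtain[OF \<phi> f(2)] by blast
  have nonneg: "0 \<le> \<phi> k x" for x
    using \<phi> by (simp add: gauge_function_def)
  define g where "g N x = max (- real N) (min (real N) (f x))" for N x
  have g_cont: "continuous_on UNIV (g N)" for N
    unfolding g_def by (intro continuous_intros f)
  have g_le: "\<bar>g N x\<bar> \<le> N" for N x
    by (auto simp: g_def)
  have g_bound: "\<bar>g N x\<bar> \<le> B * (1 + \<phi> k x)" for N x
    using B(2)[of x] by (auto simp: g_def)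
  have "continuous_map ?T Met_TC.mtopology (\<lambda>\<mu>. \<integral>x. f x \<partial>\<mu>)"
  proof (rule Met_TC.continuous_map_uniform_limit[where F = sequentially and
        f = "\<lambda>N \<mu>. \<integral>x. g N x \<partial>\<mu>"])
    show "\<forall>\<^sub>F N in sequentially. continuous_map ?T Met_TC.mtopology (\<lambda>\<mu>. \<integral>x. g N x \<partial>\<mu>)"
    proof (rule always_eventually, rule allI)
      fix N
      have "bounded (range (g N))"
        using g_le[of N] by (auto simp: bounded_iff)
      with g_cont show "continuous_map ?T Met_TC.mtopology (\<lambda>\<mu>. \<integral>x. g N x \<partial>\<mu>)"
        by (simp add: continuous_map_integral_topology)
    qed
    fix \<epsilon> :: real assume "\<epsilon> > 0"
    \<comment> \<open>The tail bound gets multiplied by \<open>2 * B\<close> below; this choice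
      leaves \<open>\<epsilon> / 2\<close>, hence a strict inequality for the distance.\<close>
    then have "\<epsilon> / (4 * B) > 0"
      using B by simp
    from uniformly_integratingD[OF M this, of k] obtain a where a: "a > 0"
      "\<And>\<mu>. \<mu> \<in> M \<Longrightarrow> (\<integral>\<^sup>+x. ennreal (\<phi> k x) * indicator {y. a \<le> \<phi> k y} x \<partial>\<mu>)
        \<le> ennreal (\<epsilon> / (4 * B))"
      by blast
    \<comment> \<open>\<open>truncation_error_le\<close> asks for a threshold of at least 1, hence
      \<open>max 1 a\<close>; going back to \<open>a\<close> only enlarges the tail set. The bound
      on \<open>N\<close> does not involve \<open>\<mu>\<close>, so the convergence is uniform on
      \<open>M\<close>.\<close>
    have small: "dist (\<integral>x. g N x \<partial>\<mu>) (\<integral>x. f x \<partial>\<mu>) < \<epsilon>"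
      if N: "B * (1 + max 1 a) \<le> real N" and "\<mu> \<in> M" for N \<mu>
    proof -
      have \<mu>: "\<mu> \<in> gauge_measures \<phi>"
        using uniformly_integrating_subset_gauge_measures[OF \<phi> M] that by auto
      then have [measurable_cong]: "sets \<mu> = sets borel"
        by (simp add: gauge_measures_def borel_prob_measures_def)
      have [measurable]: "\<phi> k \<in> borel_measurable borel"
        using \<phi> by (auto simp: gauge_function_def intro: borel_measurable_continuous_onI)
      \<comment> \<open>Integrability rules out the default value 0 of the Bochner integral and lets
        the two integrals be subtracted.\<close>
      have int: "integrable \<mu> f" "integrable \<mu> (g N)"
        using integrable_gauge_bounded[OF \<mu> \<phi>] f(1) g_cont B(2) g_bound by blast+
      have "ennreal (norm (\<integral>x. g N x - f x \<partial>\<mu>)) \<le> (\<integral>\<^sup>+x. ennreal (norm (g N x - f x)) \<partial>\<mu>)"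
        using int by (intro integral_norm_bound_ennreal) auto
      also have "\<dots> \<le> (\<integral>\<^sup>+x. ennreal (2 * B) *
          (ennreal (\<phi> k x) * indicator {y. a \<le> \<phi> k y} x) \<partial>\<mu>)"
      proof (rule nn_integral_mono)
        fix x
        have "norm (g N x - f x) \<le> 2 * B * (\<phi> k x * indicator {y. max 1 a \<le> y} (\<phi> k x))"
          using truncation_error_le[OF B(2) _ nonneg _ N] B(1) by (simp add: g_def)
        also have "\<dots> \<le> 2 * B * (\<phi> k x * indicator {y. a \<le> y} (\<phi> k x))"
          using B(1) nonneg by (intro mult_left_mono) (auto simp: indicator_def)
        finally have "ennreal (norm (g N x - f x)) \<le>
            ennreal (2 * B * (\<phi> k x * indicator {y. a \<le> y} (\<phi> k x)))"
          by (rule ennreal_leI)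
        also have "\<dots> = ennreal (2 * B) * (ennreal (\<phi> k x) * indicator {y. a \<le> \<phi> k y} x)"
          using B(1) nonneg by (auto simp: indicator_def ennreal_mult)
        finally show "ennreal (norm (g N x - f x)) \<le> \<dots>" .
      qed
      also have "\<dots> = ennreal (2 * B) *
          (\<integral>\<^sup>+x. ennreal (\<phi> k x) * indicator {y. a \<le> \<phi> k y} x \<partial>\<mu>)"
        by (rule nn_integral_cmult) measurable
      also have "\<dots> \<le> ennreal (2 * B) * ennreal (\<epsilon> / (4 * B))"
        using a(2) that by (intro mult_left_mono) auto
      also have "\<dots> = ennreal (\<epsilon> / 2)"
        using B(1) \<open>\<epsilon> > 0\<close> by (simp flip: ennreal_mult)
      finally have "norm (\<integral>x. g N x - f x \<partial>\<mu>) \<le> \<epsilon> / 2"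
        using \<open>\<epsilon> > 0\<close> by (simp add: ennreal_le_iff)
      then show ?thesis
        using int \<open>\<epsilon> > 0\<close> by (simp add: dist_norm)
    qed
    have "\<forall>\<^sub>F N in sequentially. B * (1 + max 1 a) \<le> real N"
      using filterlim_real_sequentially by (simp add: filterlim_at_top)
    then show "\<forall>\<^sub>F N in sequentially. \<forall>\<mu>\<in>topspace ?T.
        (\<integral>x. f x \<partial>\<mu>) \<in> UNIV \<and> dist (\<integral>x. g N x \<partial>\<mu>) (\<integral>x. f x \<partial>\<mu>) < \<epsilon>"
      by eventually_elim (use small in auto)
  qed auto
  then show ?thesis
    by simp
qed

text \<open>The denominator is at least 1. Hence every test function of the weak topology is one of
  the gauge weak topology.\<close>

lemma bounded_imp_gauge_bounded:
  assumes "gauge_function \<phi>" "bounded (range f)"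
  shows "bdd_above (range (\<lambda>x. \<bar>f x / (1 + \<phi> x)\<bar>))"
proof -
  obtain B where B: "\<And>x. \<bar>f x\<bar> \<le> B"
    using assms(2) by (auto simp: bounded_iff)
  have "\<bar>f x / (1 + \<phi> x)\<bar> \<le> B" for x
  proof -
    have "0 \<le> \<phi> x"
      using assms(1) by (simp add: gauge_function_def)
    then have "\<bar>f x / (1 + \<phi> x)\<bar> \<le> \<bar>f x\<bar> / 1"
      unfolding abs_divide by (intro divide_left_mono) auto
    then show ?thesis
      using B[of x] by simp
  qed
  then show ?thesis
    by (auto simp: bdd_above_def)
qed

text \<open>Each topology is the coarsest for its test functions, so it suffices that the integrals
  in either family are continuous for the other topology. From \<open>?C\<close> to
  \<open>?G\<close> this is inclusion of families; the converse is where uniform integration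
  enters.\<close>

lemma uniformly_integrating_imp_w_set:
  assumes \<phi>: "\<And>k. gauge_function (\<phi> k)" and M: "uniformly_integrating \<phi> M"
  shows "w_set \<phi> M"
proof -
  let ?G = "{f. continuous_on UNIV f \<and> (\<exists>k. bdd_above (range (\<lambda>x. \<bar>f x / (1 + \<phi> k x)\<bar>)))}"
  let ?C = "{f :: 'a \<Rightarrow> real. continuous_on UNIV f \<and> bounded (range f)}"
  have sub: "M \<subseteq> gauge_measures \<phi>"
    by (rule uniformly_integrating_subset_gauge_measures[OF \<phi> M])
  have "M \<subseteq> borel_prob_measures"
    using M by (simp add: uniformly_integrating_def)
  then have weak: "subtopology weak_topology M = integral_topology M ?C"
    unfolding weak_topology_def by (rule subtopology_integral_topology)
  have gauge: "subtopology (gauge_weak_topology \<phi>) M = integral_topology M ?G"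
    unfolding gauge_weak_topology_def by (rule subtopology_integral_topology[OF sub])
  have "openin (integral_topology M ?G) U" if "openin (integral_topology M ?C) U" for U
    using that
  proof (rule integral_topology_coarsest[rotated -1])
    fix f :: "'a \<Rightarrow> real"
    assume "f \<in> ?C"
    then have "f \<in> ?G"
      using bounded_imp_gauge_bounded[OF \<phi>[of 0], of f] by (intro CollectI conjI exI[of _ 0]) simp_all
    then show "continuous_map (integral_topology M ?G) euclideanreal (\<lambda>\<mu>. \<integral>x. f x \<partial>\<mu>)"
      by (rule continuous_map_integral_topology)
  qed simp
  moreover have "openin (integral_topology M ?C) U" if "openin (integral_topology M ?G) U" for U
    using that
    by (rule integral_topology_coarsest[rotated -1])
       (auto intro: continuous_map_integral_uniformly_integrating[OF \<phi> M])
  ultimately have "integral_topology M ?G = integral_topology M ?C"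
    by (auto simp: topology_eq)
  with sub weak gauge show ?thesis
    by (simp add: w_set_def)
qed

section \<open>Tail estimates\<close>

text \<open>Dominated convergence with \<open>g\<close> itself as majorant: at each point the
  integrand vanishes once \<open>n\<close> exceeds \<open>g x\<close>.\<close>

lemma nn_integral_tail_tendsto_0:
  fixes g :: "'a \<Rightarrow> real"
  assumes [measurable]: "g \<in> borel_measurable M" and fin: "(\<integral>\<^sup>+x. ennreal (g x) \<partial>M) < \<infinity>"
  shows "(\<lambda>n. \<integral>\<^sup>+x. ennreal (g x) * indicator {y. real n \<le> g y} x \<partial>M) \<longlonglongrightarrow> 0"
proof -
  have "(\<lambda>n. \<integral>\<^sup>+x. ennreal (g x) * indicator {y. real n \<le> g y} x \<partial>M) \<longlonglongrightarrow> (\<integral>\<^sup>+x. 0 \<partial>M)"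
  proof (rule nn_integral_dominated_convergence[where w = "\<lambda>x. ennreal (g x)"])
    show "AE x in M. (\<lambda>n. ennreal (g x) * indicator {y. real n \<le> g y} x) \<longlonglongrightarrow> 0"
    proof (rule AE_I2, rule tendsto_eventually)
      fix x
      have "\<forall>\<^sub>F n in sequentially. g x < real n"
        using filterlim_real_sequentially by (simp add: filterlim_at_top_dense)
      then show "\<forall>\<^sub>F n in sequentially. ennreal (g x) * indicator {y. real n \<le> g y} x = 0"
        by eventually_elim auto
    qed
  qed (use fin in \<open>auto simp: indicator_def\<close>)
  then show ?thesis
    by simp
qed

text \<open>A convex function on the interval from \<open>- \<bar>y\<bar>\<close> to
  \<open>\<bar>y\<bar>\<close> is bounded by its larger endpoint value, and by evenness both
  endpoint values equal \<open>f y\<close>.\<close>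

lemma convex_even_mono_abs:
  fixes f :: "real \<Rightarrow> real"
  assumes "convex_on UNIV f" "\<And>x. f (- x) = f x" "\<bar>x\<bar> \<le> \<bar>y\<bar>"
  shows "f x \<le> f y"
proof -
  have "x \<in> {- \<bar>y\<bar>..\<bar>y\<bar>}"
    using assms(3) by auto
  then have "f x \<le> max (f (- \<bar>y\<bar>)) (f \<bar>y\<bar>)"
    using convex_on_subset[OF assms(1)]
    by (intro convex_on_le_max) auto
  also have "\<dots> = f y"
    using assms(2) by (auto simp: abs_if)
  finally show ?thesis .
qed

text \<open>A sum of \<open>CARD('d) + 1\<close> terms is at most \<open>CARD('d) + 1\<close> times its largest term, which is
  either \<open>b\<close> or one of the \<open>c * \<bar>x $ i\<bar>\<close>.\<close>

lemma gauge_sum_dominated: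
  fixes x :: "real ^ 'd" and f :: "real \<Rightarrow> real"
  assumes f: "convex_on UNIV f" "\<And>x. f (- x) = f x"
    and "0 \<le> b" "0 \<le> c" "0 \<le> t" "t \<le> b + c * (\<Sum>i\<in>UNIV. \<bar>x $ i\<bar>)"
    and large: "f ((real CARD('d) + 1) * b) < f t"
  obtains i where "f t \<le> f ((real CARD('d) + 1) * c * x $ i)"
proof -
  obtain i where i: "\<And>j. \<bar>x $ j\<bar> \<le> \<bar>x $ i\<bar>"
    using ex_is_arg_min_if_finite[of UNIV "\<lambda>i. - \<bar>x $ i\<bar>"]
    by (auto simp: is_arg_min_linorder)
  have "t \<le> b + c * (real CARD('d) * \<bar>x $ i\<bar>)"
    using sum_bounded_above[of UNIV "\<lambda>j. \<bar>x $ j\<bar>", OF i] assms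
    by (smt (verit) mult_left_mono)
  then have t: "t \<le> b + real CARD('d) * (c * \<bar>x $ i\<bar>)"
    by (simp add: mult_ac)
  \<comment> \<open>Monotonicity turns \<open>large\<close> into a statement about arguments, which
    excludes \<open>b\<close> as the dominating term.\<close>
  have "\<not> t \<le> (real CARD('d) + 1) * b"
    using convex_even_mono_abs[OF f, of t "(real CARD('d) + 1) * b"] large assms by auto
  moreover have "t \<le> (real CARD('d) + 1) * b" if "c * \<bar>x $ i\<bar> \<le> b"
  proof -
    have "real CARD('d) * (c * \<bar>x $ i\<bar>) \<le> real CARD('d) * b"
      using that by (intro mult_left_mono) auto
    with t show ?thesis
      unfolding distrib_right by linarith
  qed
  ultimately have "b \<le> c * \<bar>x $ i\<bar>"
    by linarith
  with t have "t \<le> (real CARD('d) + 1) * (c * \<bar>x $ i\<bar>)"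
    by (simp add: algebra_simps)
  then have "\<bar>t\<bar> \<le> \<bar>(real CARD('d) + 1) * c * x $ i\<bar>"
    using assms by (simp add: abs_mult mult_ac)
  then show ?thesis
    using convex_even_mono_abs[OF f] that by blast
qed

text \<open>An integrand depending on one coordinate sees only that marginal. This is the source of
  uniformity over the Frechet class.\<close>

lemma nn_integral_frechet_class:
  assumes "P \<in> frechet_class \<mu>" and [measurable]: "h \<in> borel_measurable borel"
  shows "(\<integral>\<^sup>+x. h (x $ i) \<partial>P) = (\<integral>\<^sup>+x. h x \<partial>\<mu> i)"
proof -
  have [measurable_cong]: "sets P = sets borel" and "distr P borel (\<lambda>x. x $ i) = \<mu> i"
    using assms by (auto simp: frechet_class_def borel_prob_measures_def)
  then have "(\<integral>\<^sup>+x. h x \<partial>\<mu> i) = (\<integral>\<^sup>+x. h x \<partial>distr P borel (\<lambda>x. x $ i))"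
    by simp
  also have "\<dots> = (\<integral>\<^sup>+x. h (x $ i) \<partial>P)"
    by (rule nn_integral_distr) measurable
  finally show ?thesis ..
qed

theorem proposition3p9:
  fixes A :: "real ^ 'd \<Rightarrow> real ^ 'r"
    and \<mu> :: "'d \<Rightarrow> real measure"
    and \<psi> :: "nat \<Rightarrow> real \<Rightarrow> real"
    and b c :: real
  assumes A_meas: "A \<in> borel_measurable borel"
    and marg: "\<And>i. \<mu> i \<in> borel_prob_measures"
    and gauge: "\<And>k. gauge_function (\<psi> k)"
    and conv: "\<And>k. convex_on UNIV (\<psi> k)"
    and even: "\<And>k x. \<psi> k (- x) = \<psi> k x"
    and bc_pos: "b > 0" "c > 0"
    and growth: "\<And>x. norm (A x) \<le> b + c * (\<Sum>i\<in>UNIV. \<bar>x $ i\<bar>)"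
    and dilation: "\<And>k. \<exists>l. \<exists>C>0. \<forall>x. \<psi> k ((real CARD('d) + 1) * c * x) \<le> C * \<psi> l x"
    and integ: "\<And>k i. (\<integral>\<^sup>+x. ennreal (\<psi> k x) \<partial>\<mu> i) < \<infinity>"
  defines "\<psi>' \<equiv> \<lambda>k (y :: real ^ 'r). \<psi> k (norm y)"
    and "M \<equiv> {distr P borel A | P. P \<in> frechet_class \<mu>}"
  shows "uniformly_integrating \<psi>' M \<and> w_set \<psi>' M"

proof -
  have gauge': "gauge_function (\<psi>' k)" for k
    using gauge[of k] unfolding gauge_function_def \<psi>'_def
    by (auto intro!: continuous_on_compose2[of UNIV "\<psi> k"] continuous_intros)
  have \<psi>_meas [measurable]: "\<psi> k \<in> borel_measurable borel" for k
    using gauge by (auto simp: gauge_function_def intro: borel_measurable_continuous_onI)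
  have \<psi>_nonneg: "0 \<le> \<psi> k x" for k x
    using gauge by (simp add: gauge_function_def)
  note A_meas [measurable]
  have "uniformly_integrating \<psi>' M"
    unfolding uniformly_integrating_def
  proof (intro conjI allI impI)
    show "M \<subseteq> borel_prob_measures"
      using A_meas
      by (auto simp: M_def frechet_class_def borel_prob_measures_def
          intro!: prob_space.prob_space_distr cong: measurable_cong_sets)
  next
    fix \<epsilon> :: real and k assume "\<epsilon> > 0"
    obtain l C where C: "C > 0" "\<And>x. \<psi> k ((real CARD('d) + 1) * c * x) \<le> C * \<psi> l x"
      using dilation by blast
    define g where "g x = C * \<psi> l x" for x
    have g_meas [measurable]: "g \<in> borel_measurable borel"
      unfolding g_def by measurable
    \<comment> \<open>The cut is made at values of the majorant \<open>g\<close>, so that each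
      \<open>tail n\<close> is a function of a single coordinate.\<close>
    define tail where "tail n x = ennreal (g x) * indicator {y. real n \<le> g y} x" for n x
    have tail_meas [measurable]: "tail n \<in> borel_measurable borel" for n
      unfolding tail_def by measurable
    have "(\<lambda>n. \<integral>\<^sup>+x. tail n x \<partial>\<mu> i) \<longlonglongrightarrow> 0" for i
      unfolding tail_def
    proof (rule nn_integral_tail_tendsto_0)
      have [measurable_cong]: "sets (\<mu> i) = sets borel"
        using marg by (simp add: borel_prob_measures_def)
      show "g \<in> borel_measurable (\<mu> i)"
        by measurable
      have "(\<integral>\<^sup>+x. ennreal (g x) \<partial>\<mu> i) = ennreal C * (\<integral>\<^sup>+x. ennreal (\<psi> l x) \<partial>\<mu> i)"
        using C \<psi>_nonneg by (simp add: g_def ennreal_mult nn_integral_cmult)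
      also have "\<dots> < \<infinity>"
        using integ by (simp add: ennreal_mult_less_top)
      finally show "(\<integral>\<^sup>+x. ennreal (g x) \<partial>\<mu> i) < \<infinity>" .
    qed
    \<comment> \<open>There are finitely many coordinates, so one \<open>n\<close> serves all
      marginals at once.\<close>
    then have "(\<lambda>n. \<Sum>i\<in>UNIV. \<integral>\<^sup>+x. tail n x \<partial>\<mu> i) \<longlonglongrightarrow> (\<Sum>i\<in>(UNIV :: 'd set). 0)"
      by (intro tendsto_sum)
    then have "\<forall>\<^sub>F n in sequentially. (\<Sum>i\<in>UNIV. \<integral>\<^sup>+x. tail n x \<partial>\<mu> i) < ennreal \<epsilon>"
      using \<open>\<epsilon> > 0\<close> by (intro order_tendstoD(2)) auto
    \<comment> \<open>This second demand on \<open>n\<close> supplies the hypothesis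
      \<open>large\<close> of \<open>gauge_sum_dominated\<close> wherever
      \<open>\<psi>' k (A x) \<ge> n\<close>. It also forces \<open>n > 0\<close>, as
      \<open>\<psi> k\<close> is nonnegative.\<close>
    moreover have "\<forall>\<^sub>F n in sequentially. \<psi> k ((real CARD('d) + 1) * b) < real n"
      using filterlim_real_sequentially by (simp add: filterlim_at_top_dense)
    ultimately obtain n where n: "(\<Sum>i\<in>UNIV. \<integral>\<^sup>+x. tail n x \<partial>\<mu> i) < ennreal \<epsilon>"
      "\<psi> k ((real CARD('d) + 1) * b) < real n"
      using eventually_happens'[OF sequentially_bot eventually_conj] by blast
    have pointwise: "ennreal (\<psi>' k (A x)) * indicator {y. real n \<le> \<psi>' k y} (A x) \<le>
        (\<Sum>i\<in>UNIV. tail n (x $ i))" for x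
    proof (cases "real n \<le> \<psi>' k (A x)")
      case True
      then have "\<psi> k ((real CARD('d) + 1) * b) < \<psi> k (norm (A x))"
        using n(2) by (simp add: \<psi>'_def)
      then obtain i where "\<psi> k (norm (A x)) \<le> \<psi> k ((real CARD('d) + 1) * c * x $ i)"
        using gauge_sum_dominated[OF conv even _ _ norm_ge_zero growth] bc_pos
        by (metis less_imp_le)
      then have i: "\<psi>' k (A x) \<le> g (x $ i)"
        using C(2)[of "x $ i"] by (simp add: \<psi>'_def g_def)
      \<comment> \<open>From \<open>n \<le> \<psi>' k (A x) \<le> g (x $ i)\<close> the indicator
        inside \<open>tail n (x $ i)\<close> equals 1.\<close>
      with True have "ennreal (\<psi>' k (A x)) * indicator {y. real n \<le> \<psi>' k y} (A x) \<le> tail n (x $ i)"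
        by (simp add: tail_def ennreal_leI)
      \<comment> \<open>The coordinate \<open>i\<close> depends on \<open>x\<close>; summing over
        all coordinates removes this dependence before integrating.\<close>
      also have "\<dots> \<le> (\<Sum>i\<in>UNIV. tail n (x $ i))"
        by (rule member_le_sum) auto
      finally show ?thesis .
    qed simp
    have bound: "(\<integral>\<^sup>+y. ennreal (\<psi>' k y) * indicator {y. real n \<le> \<psi>' k y} y \<partial>\<nu>) \<le> ennreal \<epsilon>"
      if \<nu>: "\<nu> \<in> M" for \<nu>
    proof -
      obtain P where P: "P \<in> frechet_class \<mu>" "\<nu> = distr P borel A"
        using \<nu> by (auto simp: M_def)
      then have [measurable_cong]: "sets P = sets borel"
        by (simp add: frechet_class_def borel_prob_measures_def)
      have [measurable]: "\<psi>' k \<in> borel_measurable borel"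
        unfolding \<psi>'_def by measurable
      have "(\<integral>\<^sup>+y. ennreal (\<psi>' k y) * indicator {y. real n \<le> \<psi>' k y} y \<partial>\<nu>) =
          (\<integral>\<^sup>+x. ennreal (\<psi>' k (A x)) * indicator {y. real n \<le> \<psi>' k y} (A x) \<partial>P)"
        unfolding P(2) by (rule nn_integral_distr) measurable
      also have "\<dots> \<le> (\<integral>\<^sup>+x. (\<Sum>i\<in>UNIV. tail n (x $ i)) \<partial>P)"
        by (intro nn_integral_mono pointwise)
      also have "\<dots> = (\<Sum>i\<in>UNIV. \<integral>\<^sup>+x. tail n (x $ i) \<partial>P)"
        by (rule nn_integral_sum) measurable
      also have "\<dots> = (\<Sum>i\<in>UNIV. \<integral>\<^sup>+x. tail n x \<partial>\<mu> i)"
        using nn_integral_frechet_class[OF P(1)] by simp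
      finally show ?thesis
        using n(1) by simp
    qed
    have "real n > 0"
      using n(2) \<psi>_nonneg by (rule le_less_trans[rotated])
    then show "\<exists>a>0. (SUP \<nu>\<in>M. \<integral>\<^sup>+y. ennreal (\<psi>' k y) * indicator {y. a \<le> \<psi>' k y} y \<partial>\<nu>)
        \<le> ennreal \<epsilon>"
      using bound by (intro exI[of _ "real n"]) (auto intro: SUP_least)
  qed
  then show ?thesis
    using uniformly_integrating_imp_w_set[OF gauge'] by simp
qed

end
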